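(* There is a quiescently terminating content-oblivious algorithm of message complexity $n(2\cdot \mathrm{ID}_{\max}+1)$ that elects a leader in oriented rings of $n$ nodes with unique IDs, where $\mathrm{ID}_{\max}$ is the largest ID assigned to a node.
   Context: Content-oblivious model: a ring of $n$ nodes, each node having two ports (Port 0 and Port 1), each connected by a bidirectional channel to one of its two neighbours. All messages are fully corrupted, so a message is a content-free "pulse". The network is asynchronous: every pulse is delivered after an arbitrary but finite delay; pulses are never lost or injected. Nodes are event-driven: a node may act once at the start and afterwards only when it processes a received pulse; its actions (changing state, sending any number of pulses on each port) depend only on its own ID and the sequence of pulses it has received so far (with the port each arrived on). Algorithms are uniform: nodes do not know $n$ or any bound on it. Each node $v$ has a unique ID $\mathrm{ID}(v)\in\mathbb{N}$; $\mathrm{ID}_{\max}=\max_v \mathrm{ID}(v)$. The ring is oriented: if every node forwards a pulse received on one port out of its Port 1, the pulse travels through all edges of the ring (Port 1 is the clockwise port). Leader election: every node must terminate with output Leader or Non-Leader, exactly one node outputting Leader. Termination: each node eventually decides its output and enters a terminating state, after which it ignores incoming pulses and sends none. Quiescent termination: additionally, when the last node terminates, no pulses are in transit. Message complexity: total number of pulses sent in a worst-case execution. *)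

theory Defs
  imports Main "HOL-Library.Extended_Nat"
begin

datatype port = Port0 | Port1

datatype verdict = Leader | NonLeader

text \<open>
  An action consists of the number of pulses to send on each port and, if the node enters
  its terminating state with this action, the output it decides on.  The pulses of a
  terminating action are still sent.
\<close>

datatype action = Action (pulses: "port \<Rightarrow> nat") (decision: "verdict option")

text \<open>
  A content-oblivious algorithm maps the ID of a node and the list of the ports at which the
  node has processed pulses so far, in chronological order, to the action triggered by the
  last of these pulses; the empty list yields the action at the start.  As the local state is
  a function of this information, no separate notion of state is needed.  The number of
  nodes is not an argument, so an algorithm is uniform.
\<close>

type_synonym algorithm = "nat \<Rightarrow> port list \<Rightarrow> action"

text \<open>
  The nodes of the oriented ring are \<open>0, \<dots>, n - 1\<close> in clockwise order.  \<open>peer n (v, p)\<close> is the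
  other end of the channel at port \<open>p\<close> of node \<open>v\<close>: Port 1 leads clockwise and is joined to
  Port 0 of the next node.
\<close>

fun peer :: "nat \<Rightarrow> nat \<times> port \<Rightarrow> nat \<times> port" where
  "peer n (v, Port1) = ((v + 1) mod n, Port0)"
| "peer n (v, Port0) = ((v + n - 1) mod n, Port1)"

text \<open>
  \<open>transit c (v, p)\<close> is the number of pulses travelling towards port \<open>p\<close> of node \<open>v\<close>; pulses
  being indistinguishable, a channel direction is described by this number.  \<open>sent c\<close> is the
  number of pulses that all nodes together have sent so far.
\<close>

record config =
  history :: "nat \<Rightarrow> port list"
  outcome :: "nat \<Rightarrow> verdict option"
  transit :: "nat \<times> port \<Rightarrow> nat"
  sent :: nat

definition initial :: "algorithm \<Rightarrow> nat \<Rightarrow> (nat \<Rightarrow> nat) \<Rightarrow> config" where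
  "initial A n ID = \<lparr>
     history = (\<lambda>v. []),
     outcome = (\<lambda>v. decision (A (ID v) [])),
     transit = (\<lambda>e. let (u, q) = peer n e in pulses (A (ID u) []) q),
     sent = (\<Sum>v<n. pulses (A (ID v) []) Port0 + pulses (A (ID v) []) Port1) \<rparr>"

text \<open>
  The configuration after node \<open>v\<close> receives a pulse at port \<open>p\<close>.  A terminated node ignores the
  pulse, which only disappears from the channel.
\<close>

definition receive ::
  "algorithm \<Rightarrow> nat \<Rightarrow> (nat \<Rightarrow> nat) \<Rightarrow> nat \<times> port \<Rightarrow> config \<Rightarrow> config" where
  "receive A n ID = (\<lambda>(v, p) c.
     let rest = (transit c)((v, p) := transit c (v, p) - 1) in
     if outcome c v \<noteq> None then c\<lparr>transit := rest\<rparr>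
     else
       let h = history c v @ [p]; a = A (ID v) h in
       \<lparr> history = (history c)(v := h),
         outcome = (outcome c)(v := decision a),
         transit = (\<lambda>e. rest e + (let (u, q) = peer n e in if u = v then pulses a q else 0)),
         sent = sent c + pulses a Port0 + pulses a Port1 \<rparr>)"

text \<open>
  An asynchronous execution: at every time either nothing happens or one pulse in transit,
  chosen by the adversary, is delivered (and processed).  The last conjunct says that every
  pulse is delivered after a finite delay.
\<close>

definition execution ::
  "algorithm \<Rightarrow> nat \<Rightarrow> (nat \<Rightarrow> nat) \<Rightarrow> (nat \<Rightarrow> (nat \<times> port) option) \<Rightarrow> (nat \<Rightarrow> config) \<Rightarrow> bool"
where
  "execution A n ID sched c \<longleftrightarrow>
     c 0 = initial A n ID \<and>
     (\<forall>t. case sched t of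
            None \<Rightarrow> c (Suc t) = c t
          | Some (v, p) \<Rightarrow>
              v < n \<and> transit (c t) (v, p) > 0 \<and> c (Suc t) = receive A n ID (v, p) (c t)) \<and>
     (\<forall>t v p. v < n \<and> transit (c t) (v, p) > 0 \<longrightarrow> (\<exists>t'\<ge>t. sched t' = Some (v, p)))"

definition executions :: "algorithm \<Rightarrow> nat \<Rightarrow> (nat \<Rightarrow> nat) \<Rightarrow> (nat \<Rightarrow> config) set" where
  "executions A n ID = {c. \<exists>sched. execution A n ID sched c}"

definition all_terminated :: "nat \<Rightarrow> config \<Rightarrow> bool" where
  "all_terminated n c \<longleftrightarrow> (\<forall>v<n. outcome c v \<noteq> None)"

definition quiescent :: "nat \<Rightarrow> config \<Rightarrow> bool" where
  "quiescent n c \<longleftrightarrow> (\<forall>v<n. \<forall>p. transit c (v, p) = 0)"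

definition elects_leader :: "algorithm \<Rightarrow> nat \<Rightarrow> (nat \<Rightarrow> nat) \<Rightarrow> bool" where
  "elects_leader A n ID \<longleftrightarrow>
     (\<forall>c \<in> executions A n ID. \<exists>t. all_terminated n (c t) \<and>
        (\<exists>!v. v < n \<and> outcome (c t) v = Some Leader))"

text \<open>
  The least time at which all nodes have terminated is the moment when the last one does.
\<close>

definition quiescently_terminating :: "algorithm \<Rightarrow> nat \<Rightarrow> (nat \<Rightarrow> nat) \<Rightarrow> bool" where
  "quiescently_terminating A n ID \<longleftrightarrow>
     (\<forall>c \<in> executions A n ID.
        (\<exists>t. all_terminated n (c t)) \<and>
        quiescent n (c (LEAST t. all_terminated n (c t))))"

definition total_pulses :: "(nat \<Rightarrow> config) \<Rightarrow> enat" where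
  "total_pulses c = (SUP t. enat (sent (c t)))"

definition message_complexity :: "algorithm \<Rightarrow> nat \<Rightarrow> (nat \<Rightarrow> nat) \<Rightarrow> enat" where
  "message_complexity A n ID = (SUP c \<in> executions A n ID. total_pulses c)"

end

theory Submission
  imports Defs
begin

text \<open>
  Write \<open>a\<close> and \<open>b\<close> for the numbers of clockwise and counterclockwise pulses a node has
  received.  Every node launches one clockwise pulse and forwards all clockwise pulses except
  the \<open>ID\<close>-th, which it absorbs; this stabilises with \<open>a\<close> equal to the maximal ID
  everywhere.  Once \<open>a \<ge> ID\<close>, the node does the same in the counterclockwise direction, catching
  up on the counterclockwise pulses that have arrived in the meantime.  This second wave lags
  behind the first: \<open>a = ID \<le> b\<close> is possible only at the node of maximal ID, and only when the
  first wave is over.  That node then emits one additional counterclockwise pulse, which is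
  recognised through \<open>b > a\<close>; it travels once around the ring, and each node terminates when
  it has received it.

  The number of pulses sent by a node so far is a function of \<open>ID\<close>, \<open>a\<close> and \<open>b\<close>, so that all
  reachable configurations are described by the equations ``received + in transit = sent by
  the neighbour''; the analysis consists of propagating inequalities around the ring.
\<close>

section \<open>The algorithm in terms of pulse counts\<close>

definition cw_sent :: "nat \<Rightarrow> nat \<Rightarrow> nat" where
  "cw_sent i a = (if a < i then a + 1 else a)"

text \<open>
  In the third case the node takes itself for the leader: the value \<open>i + 1\<close> includes the
  additional pulse, and the pulse \<open>b = i + 1\<close> is not forwarded.
\<close>

definition ccw_sent :: "nat \<Rightarrow> nat \<Rightarrow> nat \<Rightarrow> nat" where
  "ccw_sent i a b =
     (if a < i then 0 else if b < i then b + 1 else if a = i then i + 1 else b)"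

text \<open>At termination \<open>a\<close> is the maximal ID at every node, so \<open>a = i\<close>
  singles out its owner.\<close>

definition verdict_of :: "nat \<Rightarrow> nat \<Rightarrow> nat \<Rightarrow> verdict option" where
  "verdict_of i a b =
     (if i \<le> a \<and> a < b then Some (if a = i then Leader else NonLeader) else None)"

fun total_sent :: "nat \<Rightarrow> port list \<Rightarrow> port \<Rightarrow> nat" where
  "total_sent i h Port1 = cw_sent i (count_list h Port0)"
| "total_sent i h Port0 = ccw_sent i (count_list h Port0) (count_list h Port1)"

text \<open>
  The subtraction is not truncated in reachable configurations: see \<open>total_sent_step\<close>.
\<close>

definition two_wave :: algorithm where
  "two_wave i h = Action
     (\<lambda>p. total_sent i h p - (if h = [] then 0 else total_sent i (butlast h) p))
     (verdict_of i (count_list h Port0) (count_list h Port1))"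

lemma two_wave_simps:
  "pulses (two_wave i []) q = total_sent i [] q"
  "pulses (two_wave i (h @ [p])) q = total_sent i (h @ [p]) q - total_sent i h q"
  "decision (two_wave i h) = verdict_of i (count_list h Port0) (count_list h Port1)"
  by (simp_all add: two_wave_def)

lemma length_eq_counts: "length h = count_list h Port0 + count_list h Port1"
proof (induction h)
  case (Cons p h)
  then show ?case by (cases p) auto
qed simp

lemma le_ccw_sent_Suc: "ccw_sent i a b \<le> ccw_sent i a (Suc b)"
  by (auto simp: ccw_sent_def)

lemma le_cw_sent_Suc: "cw_sent i a \<le> cw_sent i (Suc a)"
  by (auto simp: cw_sent_def)

text \<open>The exclusion is genuine: at \<open>a = b = i\<close> the additional pulse is already
  counted, and one more clockwise pulse would lower the value from \<open>i + 1\<close> to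
  \<open>i\<close>.\<close>

lemma le_ccw_sent_Suc_cw:
  "\<not> (a = i \<and> i \<le> b) \<Longrightarrow> ccw_sent i a b \<le> ccw_sent i (Suc a) b"
  by (auto simp: ccw_sent_def)

section \<open>Induction and monotonicity around the ring\<close>

locale ring =
  fixes n :: nat and ID :: "nat \<Rightarrow> nat"
  assumes nonempty: "n \<ge> 1"
    and inj_ID: "inj_on ID {..<n}"
    and ID_pos: "v < n \<Longrightarrow> ID v \<ge> 1"
begin

definition next_node :: "nat \<Rightarrow> nat" where
  "next_node v = (v + 1) mod n"

definition ID_max :: nat where
  "ID_max = Max (ID ` {..<n})"

lemma next_node_less [simp]: "next_node v < n"
  using nonempty by (simp add: next_node_def)

lemma peer_Port1: "peer n (v, Port1) = (next_node v, Port0)"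
  by (simp add: next_node_def)

lemma peer_less: "peer n (v, p) = (u, q) \<Longrightarrow> u < n"
  using nonempty by (cases p) auto

lemma peer_peer: "v < n \<Longrightarrow> peer n (peer n (v, p)) = (v, p)"
proof (cases p)
  case Port0
  assume "v < n"
  then show ?thesis
    using Port0 nonempty by (cases "v = 0") (auto simp: mod_if)
next
  case Port1
  assume "v < n"
  then show ?thesis
    using Port1 nonempty by (auto simp: mod_if)
qed

lemma ID_le_max: "v < n \<Longrightarrow> ID v \<le> ID_max"
  unfolding ID_max_def by (rule Max_ge) auto

lemma ID_max_attained: obtains u where "u < n" "ID u = ID_max"
proof -
  have "ID_max \<in> ID ` {..<n}"
    unfolding ID_max_def using nonempty by (intro Max_in) (auto simp: lessThan_empty_iff)
  then show thesis using that by auto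
qed

lemma ring_induct:
  assumes "v < n" "P v" and step: "\<And>w. w < n \<Longrightarrow> P w \<Longrightarrow> P (next_node w)" and "w < n"
  shows "P w"
proof -
  have "P ((v + j) mod n)" for j
  proof (induction j)
    case 0
    then show ?case using assms by simp
  next
    case (Suc j)
    have "(v + j) mod n < n" using nonempty by simp
    from step[OF this Suc] show ?case by (simp add: next_node_def mod_Suc_eq)
  qed
  \<comment> \<open>This many clockwise steps lead from \<open>v\<close> to \<open>w\<close>; adding
    \<open>n\<close> first avoids truncation.\<close>
  from this[of "w + n - v"] show ?thesis using assms by simp
qed

text \<open>Going once around returns to the starting value, so no step can decrease it.\<close>

lemma antimono_around_ring:
  fixes f :: "nat \<Rightarrow> nat"
  assumes "\<And>w. w < n \<Longrightarrow> f (next_node w) \<le> f w" "v < n" "w < n"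
  shows "f v = f w"
proof -
  have "f y \<le> f x" if "x < n" "y < n" for x y
    by (rule ring_induct[where v = x and P = "\<lambda>y. f y \<le> f x"]) (use assms that le_trans in blast)+
  then show ?thesis using assms by (simp add: order_antisym)
qed

lemma mono_around_ring:
  fixes f :: "nat \<Rightarrow> nat"
  assumes "\<And>w. w < n \<Longrightarrow> f w \<le> f (next_node w)" "v < n" "w < n"
  shows "f v = f w"
proof -
  have "f x \<le> f y" if "x < n" "y < n" for x y
    by (rule ring_induct[where v = x and P = "\<lambda>y. f x \<le> f y"]) (use assms that le_trans in blast)+
  then show ?thesis using assms by (simp add: order_antisym)
qed

end

section \<open>Static analysis of the pulse counts\<close>

text \<open>The first two assumptions are the balance equations with the pulses in transit dropped;
  the counterclockwise pulses of \<open>v\<close> come from \<open>next_node v\<close>.\<close>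

locale pulse_counts = ring +
  fixes a b :: "nat \<Rightarrow> nat"
  assumes cw_le: "v < n \<Longrightarrow> a (next_node v) \<le> cw_sent (ID v) (a v)"
    and ccw_le: "v < n \<Longrightarrow>
      b v \<le> ccw_sent (ID (next_node v)) (a (next_node v)) (b (next_node v))"
    and a_le_max: "v < n \<Longrightarrow> a v \<le> ID_max"
    and b_le_max: "v < n \<Longrightarrow> b v \<le> ID_max + 1"
begin

lemma cw_sent_le_max: "v < n \<Longrightarrow> cw_sent (ID v) (a v) \<le> ID_max"
  using a_le_max[of v] ID_le_max[of v] by (auto simp: cw_sent_def)

lemma ccw_sent_le_max: "v < n \<Longrightarrow> ccw_sent (ID v) (a v) (b v) \<le> ID_max + 1"
  using b_le_max[of v] ID_le_max[of v] by (auto simp: ccw_sent_def)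

text \<open>Clockwise from \<open>v\<close>, each node must have sent at least \<open>ID v\<close>
  counterclockwise pulses, so it has started its second wave; having received at most
  \<open>ID v\<close> clockwise pulses, it has no larger ID. Going around, \<open>ID v\<close> is
  maximal.\<close>

lemma leader_condition:
  assumes "v < n" "a v = ID v" "ID v \<le> b v"
  shows "ID v = ID_max \<and> (\<forall>w<n. a w = ID_max)"
  using assms
proof (induction "ID v" arbitrary: v rule: less_induct)
  case less
  have chain: "ID w \<le> a w \<and> a w \<le> ID v \<and> ID v \<le> b w" if "w < n" for w
  proof (rule ring_induct[where P = "\<lambda>w. ID w \<le> a w \<and> a w \<le> ID v \<and> ID v \<le> b w", OF less.prems(1) _ _ that])
    show "ID v \<le> a v \<and> a v \<le> ID v \<and> ID v \<le> b v" using less.prems by simp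
  next
    fix w assume w: "w < n" and IH: "ID w \<le> a w \<and> a w \<le> ID v \<and> ID v \<le> b w"
    let ?x = "next_node w"
    have sent: "ID v \<le> ccw_sent (ID ?x) (a ?x) (b ?x)"
      using IH ccw_le[OF w] by linarith
    \<comment> \<open>A node that has not started has sent no counterclockwise pulse, whereas
      \<open>ID v\<close> is positive.\<close>
    then have started: "ID ?x \<le> a ?x"
      using ID_pos[OF less.prems(1)] by (auto simp: ccw_sent_def split: if_splits)
    have small: "a ?x \<le> ID v"
      using cw_le[OF w] IH by (auto simp: cw_sent_def)
    have "ID v \<le> b ?x"
    proof (cases "ID ?x = ID v")
      case True
      then have "?x = v"
        using inj_ID less.prems(1) by (auto simp: inj_on_def)
      then show ?thesis using less.prems by simp
    next
      case False
      then have lt: "ID ?x < ID v" using started small by simp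
      \<comment> \<open>By induction such a node would have maximal ID. Hence \<open>?x\<close> has
        emitted no additional pulse, and what it sent bounds \<open>b ?x\<close> from below.\<close>
      have "\<not> (a ?x = ID ?x \<and> ID ?x \<le> b ?x)"
        using less.hyps[OF lt] lt ID_le_max[OF less.prems(1)] by auto
      then show ?thesis
        using sent lt by (auto simp: ccw_sent_def split: if_splits)
    qed
    then show "ID ?x \<le> a ?x \<and> a ?x \<le> ID v \<and> ID v \<le> b ?x"
      using started small by simp
  qed
  obtain u where u: "u < n" "ID u = ID_max" by (rule ID_max_attained)
  have max: "ID v = ID_max"
    using chain[OF u(1)] u(2) ID_le_max[OF less.prems(1)] by simp
  \<comment> \<open>Every node has absorbed its clockwise pulse, so it has sent just as many as it
    received.\<close>
  have "a (next_node w) \<le> a w" if "w < n" for w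
    using cw_le[OF that] chain[OF that] by (simp add: cw_sent_def)
  then have "a w = a v" if "w < n" for w
    using that less.prems(1) by (intro antimono_around_ring)
  then show ?case using max less.prems by simp
qed

text \<open>Otherwise \<open>leader_condition\<close> rules out any additional pulse, and the excess
  of \<open>b\<close> over \<open>a v\<close> spreads to the node of maximal ID, which then meets
  the leader condition itself.\<close>

lemma termination_condition:
  assumes v: "v < n" "ID v \<le> a v" "a v < b v"
  shows "\<forall>w<n. a w = ID_max"
proof (rule ccontr)
  assume "\<not> ?thesis"
  then have no_leader: "\<not> (a w = ID w \<and> ID w \<le> b w)" if "w < n" for w
    using that leader_condition by blast
  have chain: "ID w \<le> a w \<and> a w \<le> a v \<and> a v < b w" if "w < n" for w
  proof (rule ring_induct[where P = "\<lambda>w. ID w \<le> a w \<and> a w \<le> a v \<and> a v < b w", OF v(1) _ _ that])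
    show "ID v \<le> a v \<and> a v \<le> a v \<and> a v < b v" using v by simp
  next
    fix w assume w: "w < n" and IH: "ID w \<le> a w \<and> a w \<le> a v \<and> a v < b w"
    let ?x = "next_node w"
    have sent: "a v < ccw_sent (ID ?x) (a ?x) (b ?x)"
      using IH ccw_le[OF w] by linarith
    then have started: "ID ?x \<le> a ?x"
      by (auto simp: ccw_sent_def split: if_splits)
    have small: "a ?x \<le> a v"
      using cw_le[OF w] IH by (auto simp: cw_sent_def)
    have "a v < b ?x"
      using sent started small no_leader[of ?x] by (auto simp: ccw_sent_def split: if_splits)
    then show "ID ?x \<le> a ?x \<and> a ?x \<le> a v \<and> a v < b ?x"
      using started small by simp
  qed
  obtain u where u: "u < n" "ID u = ID_max" by (rule ID_max_attained)
  then show False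
    using chain[OF u(1)] a_le_max[OF u(1)] no_leader[OF u(1)] by simp
qed

text \<open>Both counts are constant around the ring, hence fixed points of the sending functions at
  the node of maximal ID; within the bounds these are unique.\<close>

lemma balanced_counts:
  assumes cw_eq: "\<And>v. v < n \<Longrightarrow> a (next_node v) = cw_sent (ID v) (a v)"
    and ccw_eq: "\<And>v. v < n \<Longrightarrow>
      b v = ccw_sent (ID (next_node v)) (a (next_node v)) (b (next_node v))"
    and v: "v < n"
  shows "a v = ID_max" "b v = ID_max + 1"
proof -
  have a_const: "a x = a y" if "x < n" "y < n" for x y
    using that cw_eq by (intro mono_around_ring) (auto simp: cw_sent_def)
  obtain u where u: "u < n" "ID u = ID_max" by (rule ID_max_attained)
  have "a u = cw_sent (ID u) (a u)"
    using cw_eq[OF u(1)] a_const[OF u(1), of "next_node u"] by simp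
  then have "a u = ID_max"
    using u a_le_max[OF u(1)] by (auto simp: cw_sent_def split: if_splits)
  then have a: "a x = ID_max" if "x < n" for x
    using a_const[OF that u(1)] by simp
  then show "a v = ID_max" using v .
  have eq: "b x = ccw_sent (ID (next_node x)) ID_max (b (next_node x))" if "x < n" for x
    using ccw_eq[OF that] a[of "next_node x"] by simp
  have b_const: "b x = b y" if "x < n" "y < n" for x y
  proof (rule antimono_around_ring[OF _ that])
    fix w assume "w < n"
    from eq[OF this] show "b (next_node w) \<le> b w"
      using b_le_max[of "next_node w"] ID_le_max[of "next_node w"]
      by (auto simp: ccw_sent_def split: if_splits)
  qed
  obtain w where peer: "peer n (u, Port0) = (w, Port1)" by simp
  then have w: "w < n" "next_node w = u"
    using peer_less peer_peer[OF u(1), of Port0, unfolded peer peer_Port1] by blast+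
  have "b u = ccw_sent ID_max ID_max (b u)"
    using eq[OF w(1)] w u b_const[OF w(1) u(1)] by simp
  then have "b u = ID_max + 1"
    by (auto simp: ccw_sent_def split: if_splits)
  then show "b v = ID_max + 1" using b_const[OF v u(1)] by simp
qed

end

section \<open>The invariant of reachable configurations\<close>

context ring
begin

abbreviation received :: "config \<Rightarrow> port \<Rightarrow> nat \<Rightarrow> nat" where
  "received c p v \<equiv> count_list (history c v) p"

abbreviation in_transit :: "config \<Rightarrow> nat \<Rightarrow> port \<Rightarrow> bool" where
  "in_transit c v p \<equiv> v < n \<and> transit c (v, p) > 0"

text \<open>The bounds are carried along because the balance equations also admit clockwise counts
  that are constant and exceed \<open>ID_max\<close>.\<close>

definition invariant :: "config \<Rightarrow> bool" where
  "invariant c \<longleftrightarrow>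
     (\<forall>v<n. \<forall>p u q. peer n (v, p) = (u, q) \<longrightarrow>
        transit c (v, p) + received c p v = total_sent (ID u) (history c u) q) \<and>
     (\<forall>v<n. outcome c v = verdict_of (ID v) (received c Port0 v) (received c Port1 v)) \<and>
     (\<forall>v<n. received c Port0 v \<le> ID_max \<and> received c Port1 v \<le> ID_max + 1) \<and>
     sent c = (\<Sum>v<n. total_sent (ID v) (history c v) Port0 + total_sent (ID v) (history c v) Port1)"

lemma invariant_balance:
  "invariant c \<Longrightarrow> v < n \<Longrightarrow> peer n (v, p) = (u, q) \<Longrightarrow>
     transit c (v, p) + received c p v = total_sent (ID u) (history c u) q"
  unfolding invariant_def by blast

lemma invariant_cw:
  assumes "invariant c" "v < n"
  shows "transit c (next_node v, Port0) + received c Port0 (next_node v)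
       = cw_sent (ID v) (received c Port0 v)"
  using invariant_balance[OF assms(1) next_node_less, of v Port0 v Port1]
    peer_peer[OF assms(2), of Port1] by (simp add: next_node_def)

lemma invariant_ccw:
  assumes "invariant c" "v < n"
  shows "transit c (v, Port1) + received c Port1 v
       = ccw_sent (ID (next_node v)) (received c Port0 (next_node v)) (received c Port1 (next_node v))"
  using invariant_balance[OF assms peer_Port1] by simp

lemma invariant_pulse_counts:
  assumes "invariant c"
  shows "pulse_counts n ID (received c Port0) (received c Port1)"
proof
  fix v assume v: "v < n"
  show "received c Port0 (next_node v) \<le> cw_sent (ID v) (received c Port0 v)"
    using invariant_cw[OF assms v] by simp
  show "received c Port1 v
     \<le> ccw_sent (ID (next_node v)) (received c Port0 (next_node v)) (received c Port1 (next_node v))"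
    using invariant_ccw[OF assms v] by simp
  show "received c Port0 v \<le> ID_max" "received c Port1 v \<le> ID_max + 1"
    using assms v by (auto simp: invariant_def)
qed

lemma no_cw_transit:
  assumes "invariant c" "\<forall>w<n. received c Port0 w = ID_max" "v < n"
  shows "transit c (v, Port0) = 0"
proof -
  obtain u q where u: "peer n (v, Port0) = (u, q)" by (cases "peer n (v, Port0)")
  then have "u < n" "q = Port1" using peer_less[OF u] by auto
  then show ?thesis
    using invariant_balance[OF assms(1,3) u] assms(2,3) ID_le_max[of u] by (simp add: cw_sent_def)
qed

text \<open>The first wave is over, so \<open>v\<close> has received at least
  \<open>ID_max + 1\<close> counterclockwise pulses, the most its neighbour can send.\<close>

lemma terminated_no_transit:
  assumes inv: "invariant c" and v: "v < n" "outcome c v \<noteq> None"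
  shows "\<forall>w<n. received c Port0 w = ID_max" "transit c (v, p) = 0"
proof -
  interpret pulse_counts n ID "received c Port0" "received c Port1"
    by (rule invariant_pulse_counts[OF inv])
  have t: "ID v \<le> received c Port0 v" "received c Port0 v < received c Port1 v"
    using inv v by (auto simp: invariant_def verdict_of_def split: if_splits)
  show all: "\<forall>w<n. received c Port0 w = ID_max"
    using termination_condition[OF v(1) t] .
  show "transit c (v, p) = 0"
  proof (cases p)
    case Port0
    then show ?thesis using no_cw_transit[OF inv all v(1)] by simp
  next
    case Port1
    then show ?thesis
      using invariant_ccw[OF inv v(1)] ccw_sent_le_max[of "next_node v"] t all v(1) by simp
  qed
qed

text \<open>The only decrease would come from a clockwise pulse reaching a node that meets the
  leader condition, but then no clockwise pulse is in transit.\<close>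

lemma total_sent_step:
  assumes inv: "invariant c" and v: "in_transit c v p"
  shows "total_sent (ID v) (history c v) q \<le> total_sent (ID v) (history c v @ [p]) q"
proof -
  interpret pulse_counts n ID "received c Port0" "received c Port1"
    by (rule invariant_pulse_counts[OF inv])
  have "\<not> (received c Port0 v = ID v \<and> ID v \<le> received c Port1 v)" if "p = Port0"
    using leader_condition[of v] no_cw_transit[OF inv, of v] v that by auto
  then show ?thesis
    by (cases p; cases q)
      (auto simp: le_cw_sent_Suc le_ccw_sent_Suc le_ccw_sent_Suc_cw)
qed

lemma invariant_initial: "invariant (initial two_wave n ID)"
  by (auto simp: invariant_def initial_def two_wave_simps)

text \<open>No pulse travels towards a terminated node, so the branch of \<open>receive\<close> that
  ignores a pulse is never taken.\<close>

lemma receive_in_transit: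
  assumes inv: "invariant c" and v: "in_transit c v p"
  defines "h \<equiv> history c v @ [p]"
  shows "receive two_wave n ID (v, p) c =
    \<lparr> history = (history c)(v := h),
      outcome = (outcome c)(v := verdict_of (ID v) (count_list h Port0) (count_list h Port1)),
      transit = (\<lambda>e. ((transit c)((v, p) := transit c (v, p) - 1)) e +
        (let (u, q) = peer n e in
          if u = v then total_sent (ID v) h q - total_sent (ID v) (history c v) q else 0)),
      sent = sent c + (total_sent (ID v) h Port0 - total_sent (ID v) (history c v) Port0)
        + (total_sent (ID v) h Port1 - total_sent (ID v) (history c v) Port1) \<rparr>"
proof -
  have "outcome c v = None"
    using terminated_no_transit(2)[OF inv, of v p] v by (metis less_irrefl)
  then show ?thesis
    by (auto simp: receive_def two_wave_simps h_def Let_def fun_eq_iff split: prod.split)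
qed

lemma invariant_receive:
  assumes inv: "invariant c" and v: "in_transit c v p"
  shows "invariant (receive two_wave n ID (v, p) c)" (is "invariant ?c")
proof -
  interpret pulse_counts n ID "received c Port0" "received c Port1"
    by (rule invariant_pulse_counts[OF inv])
  let ?h = "history c v @ [p]"
  note eq = receive_in_transit[OF inv v]
  note mono = total_sent_step[OF inv v]
  have hist: "history ?c = (history c)(v := ?h)" by (simp add: eq)
  have "transit ?c (w, r) + received ?c r w = total_sent (ID u) (history ?c u) q"
    if w: "w < n" and peer: "peer n (w, r) = (u, q)" for w r u q
  proof -
    have "transit ?c (w, r) + received ?c r w
        = transit c (w, r) + received c r w
          + (if u = v then total_sent (ID v) ?h q - total_sent (ID v) (history c v) q else 0)"
      using v peer by (auto simp: eq)
    also have "\<dots> = total_sent (ID u) (history ?c u) q"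
      using invariant_balance[OF inv w peer] mono[of q] by (auto simp: hist)
    finally show ?thesis .
  qed
  moreover have "outcome ?c w = verdict_of (ID w) (received ?c Port0 w) (received ?c Port1 w)"
    if "w < n" for w
    using inv that by (simp add: eq invariant_def)
  moreover have "received ?c Port0 w \<le> ID_max \<and> received ?c Port1 w \<le> ID_max + 1"
    if w: "w < n" for w
  proof -
    obtain u q where u: "peer n (v, p) = (u, q)" by (cases "peer n (v, p)")
    then have "u < n" by (rule peer_less)
    \<comment> \<open>The pulse being delivered was sent but not yet received, which leaves room for
      one more below the bound.\<close>
    have "received c p v < total_sent (ID u) (history c u) q"
      using invariant_balance[OF inv _ u] v by simp
    moreover have "total_sent (ID u) (history c u) q \<le> (case p of Port0 \<Rightarrow> ID_max | Port1 \<Rightarrow> ID_max + 1)"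
      using u cw_sent_le_max[OF \<open>u < n\<close>] ccw_sent_le_max[OF \<open>u < n\<close>] by (cases p) auto
    ultimately show ?thesis
      using a_le_max[OF w] b_le_max[OF w] unfolding hist by (cases p) auto
  qed
  moreover have "sent ?c = (\<Sum>w<n. total_sent (ID w) (history ?c w) Port0
      + total_sent (ID w) (history ?c w) Port1)"
  proof -
    let ?s = "\<lambda>h w. total_sent (ID w) (h w) Port0 + total_sent (ID w) (h w) Port1"
    have "(\<Sum>w<n. ?s (history ?c) w) = ?s (history ?c) v + (\<Sum>w\<in>{..<n} - {v}. ?s (history ?c) w)"
      using v by (intro sum.remove) auto
    also have "(\<Sum>w\<in>{..<n} - {v}. ?s (history ?c) w) = (\<Sum>w\<in>{..<n} - {v}. ?s (history c) w)"
      by (intro sum.cong) (auto simp: hist)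
    finally have new: "(\<Sum>w<n. ?s (history ?c) w)
      = ?s (history ?c) v + (\<Sum>w\<in>{..<n} - {v}. ?s (history c) w)" .
    have "sent c = ?s (history c) v + (\<Sum>w\<in>{..<n} - {v}. ?s (history c) w)"
      using inv v sum.remove[of "{..<n}" v "?s (history c)"] unfolding invariant_def by simp
    then show ?thesis
      unfolding new using mono[of Port0] mono[of Port1] by (simp add: eq)
  qed
  ultimately show ?thesis unfolding invariant_def by blast
qed

lemma sent_le:
  assumes "invariant c"
  shows "sent c \<le> n * (2 * ID_max + 1)"
proof -
  interpret pulse_counts n ID "received c Port0" "received c Port1"
    by (rule invariant_pulse_counts[OF assms])
  have "total_sent (ID v) (history c v) Port0 + total_sent (ID v) (history c v) Port1
      \<le> 2 * ID_max + 1" if "v < n" for v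
    using cw_sent_le_max[OF that] ccw_sent_le_max[OF that] by simp
  then have "sent c \<le> (\<Sum>v<n. 2 * ID_max + 1)"
    using assms unfolding invariant_def by (simp only:) (rule sum_mono, simp)
  then show ?thesis by simp
qed

text \<open>With nothing in transit the inequalities become those equations of
  \<open>balanced_counts\<close>; each node has then sent \<open>ID_max\<close> clockwise and
  \<open>ID_max + 1\<close> counterclockwise pulses.\<close>

lemma quiescent_final:
  assumes inv: "invariant c" and quiescent: "quiescent n c"
  shows "all_terminated n c" "sent c = n * (2 * ID_max + 1)"
proof -
  interpret pulse_counts n ID "received c Port0" "received c Port1"
    by (rule invariant_pulse_counts[OF inv])
  have q: "transit c (v, p) = 0" if "v < n" for v p
    using quiescent that by (simp add: quiescent_def)
  have final: "received c Port0 v = ID_max" "received c Port1 v = ID_max + 1" if "v < n" for v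
  proof -
    have cw: "received c Port0 (next_node w) = cw_sent (ID w) (received c Port0 w)"
      and ccw: "received c Port1 w = ccw_sent (ID (next_node w))
        (received c Port0 (next_node w)) (received c Port1 (next_node w))" if "w < n" for w
      using invariant_cw[OF inv that] invariant_ccw[OF inv that] q that by simp_all
    show "received c Port0 v = ID_max" "received c Port1 v = ID_max + 1"
      using balanced_counts(1)[OF cw ccw that] balanced_counts(2)[OF cw ccw that] by blast+
  qed
  then show "all_terminated n c"
    using inv ID_le_max by (auto simp: all_terminated_def invariant_def verdict_of_def)
  have "total_sent (ID v) (history c v) Port0 + total_sent (ID v) (history c v) Port1
      = 2 * ID_max + 1" if "v < n" for v
    using final[OF that] ID_le_max[OF that] by (auto simp: cw_sent_def ccw_sent_def)
  then have "sent c = (\<Sum>v<n. 2 * ID_max + 1)"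
    using inv unfolding invariant_def by simp
  then show "sent c = n * (2 * ID_max + 1)" by simp
qed

lemma all_terminated_quiescent:
  "invariant c \<Longrightarrow> all_terminated n c \<Longrightarrow> quiescent n c"
  using terminated_no_transit(2) by (auto simp: all_terminated_def quiescent_def)

lemma all_terminated_leader:
  assumes inv: "invariant c" and "all_terminated n c"
  shows "\<exists>!v. v < n \<and> outcome c v = Some Leader"
proof -
  have t: "outcome c v \<noteq> None" if "v < n" for v
    using assms that by (simp add: all_terminated_def)
  have iff: "outcome c v = Some Leader \<longleftrightarrow> ID v = ID_max" if "v < n" for v
    using inv t[OF that] that terminated_no_transit(1)[OF inv that t[OF that]]
    by (auto simp: invariant_def verdict_of_def split: if_splits)
  obtain u where "u < n" "ID u = ID_max" by (rule ID_max_attained)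
  then show ?thesis
    using iff inj_ID by (auto simp: inj_on_def)
qed

section \<open>Runs, finiteness of deliveries and fairness\<close>

text \<open>Fairness is left out: finiteness of deliveries holds without it and serves to construct
  a fair schedule.\<close>

definition run :: "(nat \<Rightarrow> (nat \<times> port) option) \<Rightarrow> (nat \<Rightarrow> config) \<Rightarrow> bool" where
  "run sched c \<longleftrightarrow> c 0 = initial two_wave n ID \<and>
     (\<forall>t. case sched t of
            None \<Rightarrow> c (Suc t) = c t
          | Some (v, p) \<Rightarrow> in_transit (c t) v p \<and> c (Suc t) = receive two_wave n ID (v, p) (c t))"

lemma run_idle: "run sched c \<Longrightarrow> sched t = None \<Longrightarrow> c (Suc t) = c t"
  unfolding run_def by (auto dest!: spec[of _ t])

lemma run_delivery:
  assumes "run sched c" "sched t = Some (v, p)"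
  shows "in_transit (c t) v p" "c (Suc t) = receive two_wave n ID (v, p) (c t)"
  using assms unfolding run_def by (auto dest!: spec[of _ t])

lemma run_invariant:
  assumes "run sched c"
  shows "invariant (c t)"
proof (induction t)
  case 0
  then show ?case using assms by (simp add: run_def invariant_initial)
next
  case (Suc t)
  then show ?case
    using run_idle[OF assms, of t] run_delivery[OF assms, of t] invariant_receive
    by (cases "sched t") auto
qed

definition deliveries :: "config \<Rightarrow> nat" where
  "deliveries c = (\<Sum>v<n. length (history c v))"

lemma deliveries_le:
  assumes "invariant c"
  shows "deliveries c \<le> n * (2 * ID_max + 1)"
proof -
  have "deliveries c \<le> (\<Sum>v<n. 2 * ID_max + 1)"
    unfolding deliveries_def length_eq_counts
    using assms by (intro sum_mono) (fastforce simp: invariant_def)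
  then show ?thesis by simp
qed

lemma deliveries_receive:
  assumes "invariant c" "in_transit c v p"
  shows "deliveries (receive two_wave n ID (v, p) c) = Suc (deliveries c)"
proof -
  have "(\<Sum>w<n. length (((history c)(v := history c v @ [p])) w))
      = (\<Sum>w<n. length (history c w) + (if w = v then 1 else 0))"
    by (intro sum.cong) auto
  then show ?thesis
    using assms by (simp add: deliveries_def receive_in_transit sum.distrib)
qed

text \<open>\<open>deliveries\<close> grows by one with each delivery and is bounded by the
  invariant, so it attains a maximum.\<close>

lemma run_eventually_idle:
  assumes "run sched c"
  shows "\<exists>T. \<forall>t\<ge>T. sched t = None"
proof -
  let ?d = "\<lambda>t. deliveries (c t)"
  have step: "?d (Suc t) = ?d t + (if sched t = None then 0 else 1)" for t
    using run_idle[OF assms, of t] run_delivery[OF assms, of t]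
      deliveries_receive[OF run_invariant[OF assms, of t]]
    by (cases "sched t") auto
  have mono: "?d s \<le> ?d t" if "s \<le> t" for s t
    using that by (rule lift_Suc_mono_le[rotated]) (simp add: step)
  have "\<forall>t. True \<longrightarrow> ?d t < Suc (n * (2 * ID_max + 1))"
    using deliveries_le[OF run_invariant[OF assms]] by (simp add: less_Suc_eq_le)
  then obtain T where T: "\<forall>t. ?d t \<le> ?d T"
    using ex_has_greatest_nat[of "\<lambda>_. True" 0 ?d] by blast
  have "sched t = None" if "T \<le> t" for t
    using T[rule_format, of "Suc t"] mono[OF that] step[of t] by (auto split: if_splits)
  then show ?thesis by blast
qed

lemma execution_iff_run:
  "execution two_wave n ID sched c \<longleftrightarrow>
     run sched c \<and> (\<forall>t v p. in_transit (c t) v p \<longrightarrow> (\<exists>t'\<ge>t. sched t' = Some (v, p)))"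
  unfolding execution_def run_def conj_assoc by (rule refl)

lemma execution_invariant: "c \<in> executions two_wave n ID \<Longrightarrow> invariant (c t)"
  using run_invariant by (auto simp: executions_def execution_iff_run)

lemma execution_eventually_quiescent:
  assumes "c \<in> executions two_wave n ID"
  obtains T where "quiescent n (c T)"
proof -
  obtain sched where run: "run sched c"
    and fair: "\<And>t v p. in_transit (c t) v p \<Longrightarrow> \<exists>t'\<ge>t. sched t' = Some (v, p)"
    using assms by (auto simp: executions_def execution_iff_run)
  obtain T where "\<And>t. T \<le> t \<Longrightarrow> sched t = None"
    using run_eventually_idle[OF run] by blast
  then have "\<not> in_transit (c T) v p" for v p
    using fair by (metis option.distinct(1))
  then have "quiescent n (c T)" by (simp add: quiescent_def)
  then show thesis by (rule that)
qed

text \<open>Deliveries elsewhere can only add pulses to a channel.\<close>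

lemma in_transit_persists:
  assumes run: "run sched c" and "in_transit (c s) v p" "s \<le> t"
    and undelivered: "\<And>t. s \<le> t \<Longrightarrow> sched t \<noteq> Some (v, p)"
  shows "in_transit (c t) v p"
  using \<open>s \<le> t\<close>
proof (induction rule: dec_induct)
  case (step t)
  show ?case
  proof (cases "sched t")
    case None
    then show ?thesis using step.IH run_idle[OF run] by simp
  next
    case (Some e)
    obtain w q where e: "e = (w, q)" by (cases e)
    have "c (Suc t) = receive two_wave n ID (w, q) (c t)" "in_transit (c t) w q"
      using run_delivery[OF run] Some e by auto
    moreover have "(v, p) \<noteq> (w, q)"
      using undelivered[OF step.hyps(1)] Some e by auto
    ultimately show ?thesis
      using step.IH receive_in_transit[OF run_invariant[OF run]] by auto
  qed
qed (use assms in simp)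

text \<open>
  Delivering an arbitrary pulse whenever there is one is fair, because such a run becomes
  quiescent, so that no pulse is postponed forever.
\<close>

lemma executions_nonempty: "executions two_wave n ID \<noteq> {}"
proof -
  define pick :: "config \<Rightarrow> (nat \<times> port) option" where
    "pick c = (if quiescent n c then None else Some (SOME e. in_transit c (fst e) (snd e)))" for c
  define step where
    "step c = (case pick c of None \<Rightarrow> c | Some e \<Rightarrow> receive two_wave n ID e c)" for c
  define c where "c t = (step ^^ t) (initial two_wave n ID)" for t
  have pick: "in_transit c v p" if "pick c = Some (v, p)" for c v p
  proof -
    have "\<not> quiescent n c" using that by (auto simp: pick_def)
    then have "\<exists>e. in_transit c (fst e) (snd e)"
      by (auto simp: quiescent_def)
    from someI_ex[OF this] show ?thesis
      using that by (auto simp: pick_def split: if_splits)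
  qed
  have run: "run (pick \<circ> c) c"
    using pick by (auto simp: run_def c_def step_def split: option.split)
  obtain T where T: "\<And>t. T \<le> t \<Longrightarrow> (pick \<circ> c) t = None"
    using run_eventually_idle[OF run] by blast
  have "\<exists>t'\<ge>t. (pick \<circ> c) t' = Some (v, p)" if "in_transit (c t) v p" for t v p
  proof (rule ccontr)
    assume "\<not> ?thesis"
    then have "in_transit (c (max t T)) v p"
      using in_transit_persists[OF run that, of "max t T"] by auto
    moreover have "quiescent n (c (max t T))"
      using T[of "max t T"] by (auto simp: pick_def split: if_splits)
    ultimately show False by (auto simp: quiescent_def)
  qed
  with run show ?thesis
    unfolding executions_def execution_iff_run by blast
qed

section \<open>Election, quiescent termination and complexity\<close>

lemma execution_terminates:
  assumes "c \<in> executions two_wave n ID"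
  shows "\<exists>t. all_terminated n (c t)"
proof -
  obtain T where "quiescent n (c T)"
    by (rule execution_eventually_quiescent[OF assms])
  then show ?thesis
    using quiescent_final(1)[OF execution_invariant[OF assms]] by blast
qed

lemma two_wave_elects_leader: "elects_leader two_wave n ID"
  unfolding elects_leader_def
proof
  fix c assume c: "c \<in> executions two_wave n ID"
  obtain T where "all_terminated n (c T)"
    using execution_terminates[OF c] by blast
  then show "\<exists>t. all_terminated n (c t) \<and> (\<exists>!v. v < n \<and> outcome (c t) v = Some Leader)"
    using all_terminated_leader[OF execution_invariant[OF c]] by blast
qed

lemma two_wave_quiescently_terminating: "quiescently_terminating two_wave n ID"
  unfolding quiescently_terminating_def
proof
  fix c assume c: "c \<in> executions two_wave n ID"
  note ex = execution_terminates[OF c]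
  then have "all_terminated n (c (LEAST t. all_terminated n (c t)))"
    by (rule LeastI_ex)
  with ex show "(\<exists>t. all_terminated n (c t)) \<and> quiescent n (c (LEAST t. all_terminated n (c t)))"
    using all_terminated_quiescent[OF execution_invariant[OF c]] by blast
qed

text \<open>\<open>sent_le\<close> holds at all times and is attained at quiescence, so the total
  does not depend on the schedule.\<close>

lemma total_pulses_two_wave:
  assumes c: "c \<in> executions two_wave n ID"
  shows "total_pulses c = enat (n * (2 * ID_max + 1))"
proof -
  obtain T where "quiescent n (c T)"
    by (rule execution_eventually_quiescent[OF c])
  then have "sent (c T) = n * (2 * ID_max + 1)"
    using quiescent_final(2)[OF execution_invariant[OF c]] by simp
  then show ?thesis
    unfolding total_pulses_def
    using sent_le[OF execution_invariant[OF c]]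
    by (intro antisym SUP_least SUP_upper2[of T]) auto
qed

text \<open>A supremum of a constant; \<open>executions_nonempty\<close> rules out the value 0 of an
  empty supremum.\<close>

lemma message_complexity_two_wave:
  "message_complexity two_wave n ID = enat (n * (2 * ID_max + 1))"
  unfolding message_complexity_def
  using executions_nonempty total_pulses_two_wave by (simp cong: SUP_cong)

end

theorem theorem1p1:
  shows "\<exists>A :: algorithm. \<forall>(n :: nat) (ID :: nat \<Rightarrow> nat).
    n \<ge> 1 \<and> inj_on ID {..<n} \<and> (\<forall>v<n. ID v \<ge> 1) \<longrightarrow>
      elects_leader A n ID \<and>
      quiescently_terminating A n ID \<and>
      message_complexity A n ID = enat (n * (2 * Max (ID ` {..<n}) + 1))"
proof (intro exI allI impI)
  fix n :: nat and ID :: "nat \<Rightarrow> nat"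
  assume "n \<ge> 1 \<and> inj_on ID {..<n} \<and> (\<forall>v<n. ID v \<ge> 1)"
  then interpret ring n ID by unfold_locales auto
  show "elects_leader two_wave n ID \<and> quiescently_terminating two_wave n ID \<and>
      message_complexity two_wave n ID = enat (n * (2 * Max (ID ` {..<n}) + 1))"
    using two_wave_elects_leader two_wave_quiescently_terminating message_complexity_two_wave
    by (simp add: ID_max_def)
qed

end
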